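(* Let $K\ge 1$. The transfer matrix $\mathbb O_K$ satisfies the following properties. \begin{itemize} \item If $K\equiv 1\pmod 3$, then $e^{i\pi/3}$ and $e^{-i\pi/3}$ are eigenvalues of $\mathbb O_K$. \item If $K\equiv 2\pmod 3$, then all the $2K$th roots of unity, except maybe $-1$, are eigenvalues of $\mathbb O_K$. \item If $K\equiv 0\pmod 3$, then all the $(2K+2)$th roots of unity, except maybe $-1$ and, if $K$ is odd, $\pm i$, are eigenvalues of $\mathbb O_K$. \end{itemize}
   Context: The square complex matrix $\mathbb O_K$ has rows and columns indexed by the independent sets of the $K$-point segment (path) with vertices $1,2,\ldots,K$, that is, by the subsets of $\{1,\ldots,K\}$ containing no two consecutive integers. For two such sets $C$ and $D$, $$\mathbb O_K(C,D)=\begin{cases} i^{|C|+|D|}&\text{if } C\cap D=\emptyset,\\ 0&\text{otherwise,}\end{cases}$$ where $i$ is the imaginary unit. "Except maybe" means that nothing is asserted about whether the excepted numbers are eigenvalues. *)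

theory Defs
  imports Complex_Main "Jordan_Normal_Form.Char_Poly"
begin

definition segment_indep_sets :: "nat \<Rightarrow> nat set set" where
  "segment_indep_sets K = {C. C \<subseteq> {1..K} \<and> (\<forall>j\<in>C. Suc j \<notin> C)}"

definition transfer_entry :: "nat set \<Rightarrow> nat set \<Rightarrow> complex" where
  "transfer_entry C D = (if C \<inter> D = {} then \<i> ^ (card C + card D) else 0)"

(* Library matrices are indexed by {0..<n}, so the index sets are listed in some order Cs;
   orders differ only by a simultaneous permutation of rows and columns. *)
definition enumerates_indep_sets :: "nat \<Rightarrow> nat set list \<Rightarrow> bool" where
  "enumerates_indep_sets K Cs \<longleftrightarrow> distinct Cs \<and> set Cs = segment_indep_sets K"

definition transfer_matrix :: "nat set list \<Rightarrow> complex mat" where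
  "transfer_matrix Cs =
     mat (length Cs) (length Cs) (\<lambda>(r, c). transfer_entry (Cs ! r) (Cs ! c))"

lemma finite_segment_indep_sets: "finite (segment_indep_sets K)"
  by (rule finite_subset[of _ "Pow {1..K}"]) (auto simp: segment_indep_sets_def)

lemma ex_enumerates_indep_sets: "\<exists>Cs. enumerates_indep_sets K Cs"
  using finite_distinct_list[OF finite_segment_indep_sets]
  by (auto simp: enumerates_indep_sets_def)

end

theory Submission
  imports Defs
begin

text \<open>
  Conjugating by the diagonal matrix with entries \<open>(-\<i>)\<^sup>|\<^sup>C\<^sup>|\<close> turns the matrix into the
  operator \<open>transfer\<close>, which acts on functions \<open>v\<close> of independent sets by
  \<open>(T v)(C) = (-1)\<^sup>|\<^sup>C\<^sup>| (\<Sum>D. v D)\<close> with \<open>D\<close> running over the independent sets disjoint from \<open>C\<close>.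
  Its entries are integers, and an alternating sum over independent sets vanishes as soon as some
  allowed vertex is isolated, since that vertex can be added and removed freely.

  This cancellation makes \<open>T\<close> act on certain vectors like a cellular automaton.  Let
  \<open>pattern R G\<close> be the vector supported on the sets \<open>C\<close> that contain all of \<open>R\<close> and otherwise only
  vertices of \<open>G\<close>, with value \<open>(-1)\<^sup>|\<^sup>C\<^sup>|\<close> there.  If \<open>G\<close> consists of isolated vertices \<open>I\<close> and of
  pairs of neighbours, then \<open>T\<close> maps it, up to a sign, to the pattern in which the vertices of \<open>I\<close>
  are required, the vertices of \<open>R\<close> and of the pairs are forbidden, and all others are allowed
  (\<open>transfer_pattern\<close>); allowed neighbours of required vertices may then be dropped.

  The starting vector is supported on the single set \<open>S = {1, 4, 7, \<dots>}\<close>.  For \<open>K = 3m + 1\<close> the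
  automaton returns to it after three steps with the opposite sign, which yields the eigenvalues with
  \<open>z\<^sup>3 = -1\<close>.  Otherwise the right end of the segment creates a defect in this background of period
  three; the defect moves to the left by one block in every three steps, and when it has crossed the
  segment the vector is, up to a sign, supported on the mirror image of \<open>S\<close>.  The crossing takes
  \<open>n = K\<close> steps if \<open>K = 3m + 2\<close> and \<open>n = K + 1\<close> steps if \<open>K = 3m\<close>.  As \<open>T\<close> commutes with the mirror
  symmetry, \<open>T\<^sup>2\<^sup>n\<close> fixes the starting vector \<open>x\<close>, and for \<open>z\<^sup>2\<^sup>n = 1\<close> the vector
  \<open>\<Sum>j<2n. z\<^sup>-\<^sup>j T\<^sup>j x\<close> is an eigenvector unless it is zero.  That it is not zero is seen by
  evaluating it at a two-element set that lies in the support of only one vector of the orbit; in the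
  segments with 2, 3 and 5 vertices there is no room for such a set, several terms survive there, and
  they cancel only at the excepted numbers.
\<close>

section \<open>The transfer operator and eigenvectors from its orbits\<close>

definition transfer :: "nat \<Rightarrow> (nat set \<Rightarrow> complex) \<Rightarrow> nat set \<Rightarrow> complex" where
  "transfer K v C = (-1) ^ card C * (\<Sum>D | D \<in> segment_indep_sets K \<and> C \<inter> D = {}. v D)"

lemma transfer_scale: "transfer K (\<lambda>D. c * v D) C = c * transfer K v C"
  by (simp add: transfer_def sum_distrib_left mult.left_commute)

lemma transfer_cong:
  assumes "\<And>D. D \<in> segment_indep_sets K \<Longrightarrow> v D = w D"
  shows "transfer K v C = transfer K w C"
  unfolding transfer_def using assms by (auto intro!: sum.cong)

lemma transfer_add: "transfer K (\<lambda>D. v D + w D) C = transfer K v C + transfer K w C"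
  by (simp add: transfer_def sum.distrib distrib_left)

lemma transfer_sum: "transfer K (\<lambda>D. \<Sum>j\<in>J. f j D) C = (\<Sum>j\<in>J. transfer K (f j) C)"
  by (induction J rule: infinite_finite_induct)
    (simp_all add: transfer_add, simp_all add: transfer_def)

text \<open>
  The transfer matrix is \<open>D A D\<close> with \<open>D = diag(\<i>\<^sup>|\<^sup>C\<^sup>|)\<close> and \<open>A\<close> the disjointness matrix, while
  \<open>transfer\<close> is \<open>D\<^sup>2 A\<close>; so \<open>D\<^sup>-\<^sup>1\<close> maps eigenvectors of the latter to eigenvectors of the former.
\<close>

lemma eigenvalue_transfer_matrix_if:
  assumes Cs: "enumerates_indep_sets K Cs"
    and ev: "\<And>C. C \<in> segment_indep_sets K \<Longrightarrow> transfer K v C = z * v C"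
    and C0: "C0 \<in> segment_indep_sets K" "v C0 \<noteq> 0"
  shows "eigenvalue (transfer_matrix Cs) z"
proof -
  have dist: "distinct Cs" and set: "set Cs = segment_indep_sets K"
    using Cs by (auto simp: enumerates_indep_sets_def)
  define u where "u C = (- \<i>) ^ card C * v C" for C
  define U where "U = vec (length Cs) (\<lambda>r. u (Cs ! r))"
  have mult: "(\<Sum>D\<in>segment_indep_sets K. transfer_entry C D * u D) = z * u C"
    if C: "C \<in> segment_indep_sets K" for C
  proof -
    have "transfer_entry C D * u D = (if C \<inter> D = {} then \<i> ^ card C * v D else 0)" for D
    proof -
      have "\<i> ^ card D * (- \<i>) ^ card D = 1"
        by (simp flip: power_mult_distrib)
      then show ?thesis
        by (simp add: transfer_entry_def u_def power_add)
    qed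
    then have "(\<Sum>D\<in>segment_indep_sets K. transfer_entry C D * u D) =
        \<i> ^ card C * (\<Sum>D | D \<in> segment_indep_sets K \<and> C \<inter> D = {}. v D)"
      by (simp add: sum.If_cases finite_segment_indep_sets sum_distrib_left Int_def)
    also have "\<dots> = (- \<i>) ^ card C * transfer K v C"
      by (simp add: transfer_def flip: mult.assoc power_mult_distrib)
    finally show ?thesis
      using ev[OF C] by (simp add: u_def)
  qed
  have "U \<in> carrier_vec (dim_row (transfer_matrix Cs))"
    by (simp add: U_def transfer_matrix_def)
  moreover have "U \<noteq> 0\<^sub>v (dim_row (transfer_matrix Cs))"
  proof
    assume zero: "U = 0\<^sub>v (dim_row (transfer_matrix Cs))"
    obtain r where r: "r < length Cs" "Cs ! r = C0"
      using C0(1) set by (metis in_set_conv_nth)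
    have "U $ r = 0"
      using zero r by (simp add: transfer_matrix_def)
    then show False
      using r C0(2) by (simp add: U_def u_def)
  qed
  moreover have "transfer_matrix Cs *\<^sub>v U = z \<cdot>\<^sub>v U"
  proof (rule eq_vecI)
    fix r assume "r < dim_vec (z \<cdot>\<^sub>v U)"
    then have r: "r < length Cs"
      by (simp add: U_def)
    have "(transfer_matrix Cs *\<^sub>v U) $ r =
        (\<Sum>c = 0..<length Cs. transfer_entry (Cs ! r) (Cs ! c) * u (Cs ! c))"
      using r by (simp add: transfer_matrix_def U_def scalar_prod_def)
    also have "\<dots> = (\<Sum>D\<in>set Cs. transfer_entry (Cs ! r) D * u D)"
      using bij_betw_nth[OF dist refl refl]
      by (intro sum.reindex_bij_betw) (simp add: atLeast0LessThan)
    also have "\<dots> = (z \<cdot>\<^sub>v U) $ r"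
      using r mult[of "Cs ! r"] nth_mem[OF r] set by (simp add: U_def)
    finally show "(transfer_matrix Cs *\<^sub>v U) $ r = (z \<cdot>\<^sub>v U) $ r" .
  qed (simp add: U_def transfer_matrix_def)
  ultimately show ?thesis
    unfolding eigenvalue_def eigenvector_def by blast
qed

text \<open>
  If \<open>T\<^sup>n\<close> multiplies \<open>y 0\<close> by \<open>z\<^sup>n\<close>, then averaging the orbit with weights \<open>z\<^sup>-\<^sup>j\<close> projects onto the
  eigenspace of \<open>z\<close>.  The weights are scaled by \<open>z\<^sup>n\<close> to keep the exponents in \<open>nat\<close>.
\<close>

lemma eigenvalue_if_periodic_orbit:
  assumes Cs: "enumerates_indep_sets K Cs"
    and step: "\<And>j C. j < n \<Longrightarrow> C \<in> segment_indep_sets K \<Longrightarrow> transfer K (y j) C = y (Suc j) C"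
    and period: "\<And>C. C \<in> segment_indep_sets K \<Longrightarrow> y n C = z ^ n * y 0 C"
    and C0: "C0 \<in> segment_indep_sets K" "(\<Sum>j<n. z ^ (n - j) * y j C0) \<noteq> 0"
  shows "eigenvalue (transfer_matrix Cs) z"
proof (rule eigenvalue_transfer_matrix_if[OF Cs,
      where v = "\<lambda>C. \<Sum>j<n. z ^ (n - j) * y j C" and ?C0.0 = C0])
  fix C assume C: "C \<in> segment_indep_sets K"
  define f where "f j = z ^ (n - j) * y j C" for j
  have "transfer K (\<lambda>D. \<Sum>j<n. z ^ (n - j) * y j D) C = (\<Sum>j<n. z * f (Suc j))"
    unfolding transfer_sum transfer_scale
    by (intro sum.cong refl) (simp add: step C f_def Suc_diff_Suc flip: power_Suc mult.assoc)
  also have "\<dots> = z * (\<Sum>j<n. f j)"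
  proof -
    have "f n = f 0"
      using period[OF C] by (simp add: f_def)
    then show ?thesis
      using sum.lessThan_Suc_shift[of f n] by (simp add: sum_distrib_left add.commute)
  qed
  finally show "transfer K (\<lambda>C. \<Sum>j<n. z ^ (n - j) * y j C) C =
      z * (\<Sum>j<n. z ^ (n - j) * y j C)"
    by (simp add: f_def)
qed (fact C0)+

definition reflect :: "nat \<Rightarrow> nat set \<Rightarrow> nat set" where
  "reflect K C = (\<lambda>a. Suc K - a) ` C"

lemma reflect_reflect: "C \<subseteq> {1..K} \<Longrightarrow> reflect K (reflect K C) = C"
  by (force simp: reflect_def image_image)

lemma card_reflect: "C \<subseteq> {1..K} \<Longrightarrow> card (reflect K C) = card C"
  unfolding reflect_def by (intro card_image inj_onI) fastforce

lemma segment_indep_setsD: "C \<in> segment_indep_sets K \<Longrightarrow> C \<subseteq> {1..K}"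
  by (simp add: segment_indep_sets_def)

lemma reflect_segment_indep_sets:
  assumes "C \<in> segment_indep_sets K"
  shows "reflect K C \<in> segment_indep_sets K"
proof -
  have "Suc (Suc K - a) \<noteq> Suc K - b" if "a \<in> C" "b \<in> C" for a b
  proof
    assume "Suc (Suc K - a) = Suc K - b"
    moreover have "1 \<le> a" "a \<le> K" "1 \<le> b" "b \<le> K"
      using assms that by (auto simp: segment_indep_sets_def)
    ultimately have "a = Suc b" by linarith
    then show False
      using assms that by (auto simp: segment_indep_sets_def)
  qed
  moreover have "Suc K - a \<in> {1..K}" if "a \<in> C" for a
    using assms that by (force simp: segment_indep_sets_def)
  ultimately show ?thesis
    unfolding segment_indep_sets_def reflect_def by blast
qed

lemma transfer_reflect:
  assumes C: "C \<in> segment_indep_sets K"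
  shows "transfer K (\<lambda>D. v (reflect K D)) C = transfer K v (reflect K C)"
proof -
  have disj: "reflect K A \<inter> reflect K B = {}" if "A \<subseteq> {1..K}" "B \<subseteq> {1..K}" "A \<inter> B = {}" for A B
  proof -
    have "a = b" if "a \<in> A" "b \<in> B" "Suc K - a = Suc K - b" for a b
      using that \<open>A \<subseteq> _\<close> \<open>B \<subseteq> _\<close> by fastforce
    then show ?thesis
      using \<open>A \<inter> B = {}\<close> by (auto simp: reflect_def)
  qed
  have "(\<Sum>D | D \<in> segment_indep_sets K \<and> C \<inter> D = {}. v (reflect K D)) =
      (\<Sum>D | D \<in> segment_indep_sets K \<and> reflect K C \<inter> D = {}. v D)"
  proof (rule sum.reindex_bij_witness[of _ "reflect K" "reflect K"])
    fix D assume D: "D \<in> {D. D \<in> segment_indep_sets K \<and> C \<inter> D = {}}"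
    then show "reflect K D \<in> {D. D \<in> segment_indep_sets K \<and> reflect K C \<inter> D = {}}"
      using disj[OF segment_indep_setsD[OF C], of D]
      by (simp add: segment_indep_setsD reflect_segment_indep_sets del: One_nat_def)
    show "reflect K (reflect K D) = D"
      using D by (simp add: reflect_reflect segment_indep_setsD del: One_nat_def)
  next
    fix D assume D: "D \<in> {D. D \<in> segment_indep_sets K \<and> reflect K C \<inter> D = {}}"
    then show "reflect K D \<in> {D. D \<in> segment_indep_sets K \<and> C \<inter> D = {}}"
      using disj[OF segment_indep_setsD[OF reflect_segment_indep_sets[OF C]], of D]
      by (simp add: segment_indep_setsD reflect_segment_indep_sets reflect_reflect C
          del: One_nat_def)
    show "reflect K (reflect K D) = D"
      using D by (simp add: reflect_reflect segment_indep_setsD del: One_nat_def)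
  qed simp
  then show ?thesis
    using card_reflect[OF segment_indep_setsD[OF C]] by (simp add: transfer_def)
qed

text \<open>
  With \<open>\<rho>\<close> for the reflection and \<open>T\<^sup>n x = e \<cdot> x \<circ> \<rho>\<close>, the combination \<open>x + z\<^sup>n e \<cdot> x \<circ> \<rho>\<close> is an
  eigenvector of \<open>T\<^sup>n\<close> for the eigenvalue \<open>z\<^sup>n\<close>, which is 1 or -1.  Only half of the orbit of length
  \<open>2n\<close> therefore has to be known.
\<close>

lemma eigenvalue_if_reflected_orbit:
  assumes Cs: "enumerates_indep_sets K Cs"
    and step: "\<And>j C. j < n \<Longrightarrow> C \<in> segment_indep_sets K \<Longrightarrow> transfer K (x j) C = x (Suc j) C"
    and half: "\<And>C. C \<in> segment_indep_sets K \<Longrightarrow> x n C = e * x 0 (reflect K C)"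
    and e: "e * e = 1" and z: "z ^ (2 * n) = 1"
    and C0: "C0 \<in> segment_indep_sets K"
      "(\<Sum>j<n. z ^ (n - j) * (x j C0 + z ^ n * e * x j (reflect K C0))) \<noteq> 0"
  shows "eigenvalue (transfer_matrix Cs) z"
proof (rule eigenvalue_if_periodic_orbit[OF Cs,
      where y = "\<lambda>j C. x j C + z ^ n * e * x j (reflect K C)" and n = n])
  fix j C assume "j < n" "C \<in> segment_indep_sets K"
  then show "transfer K (\<lambda>C. x j C + z ^ n * e * x j (reflect K C)) C =
      x (Suc j) C + z ^ n * e * x (Suc j) (reflect K C)"
    by (simp add: transfer_add transfer_scale transfer_reflect step reflect_segment_indep_sets)
next
  fix C assume C: "C \<in> segment_indep_sets K"
  have "z ^ n * z ^ n = 1"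
    using z by (simp flip: power_add mult_2)
  then have "z ^ n * (x 0 C + z ^ n * e * x 0 (reflect K C)) =
      e * x 0 (reflect K C) + z ^ n * e * (e * x 0 C)"
    using e by (simp add: distrib_left mult.assoc[symmetric])
  then show "x n C + z ^ n * e * x n (reflect K C) =
      z ^ n * (x 0 C + z ^ n * e * x 0 (reflect K C))"
    using half[OF C] half[OF reflect_segment_indep_sets[OF C]]
      reflect_reflect[OF segment_indep_setsD[OF C]] by simp
qed (fact C0)+

section \<open>Alternating counts of independent sets\<close>

definition indep :: "nat set \<Rightarrow> bool" where
  "indep D \<longleftrightarrow> (\<forall>j\<in>D. Suc j \<notin> D)"

definition alternating_count :: "nat set \<Rightarrow> nat set \<Rightarrow> int" where
  "alternating_count R G = (\<Sum>D | indep D \<and> R \<subseteq> D \<and> D \<subseteq> R \<union> G. (-1) ^ card D)"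

lemma finite_indep_between: "finite R \<Longrightarrow> finite G \<Longrightarrow> finite {D. indep D \<and> R \<subseteq> D \<and> D \<subseteq> R \<union> G}"
  by (rule finite_subset[of _ "Pow (R \<union> G)"]) auto

lemma alternating_count_insert:
  assumes "finite R" "finite G" "a \<notin> R" "a \<notin> G"
  shows "alternating_count R (insert a G) = alternating_count R G + alternating_count (insert a R) G"
proof -
  have "{D. indep D \<and> R \<subseteq> D \<and> D \<subseteq> R \<union> insert a G} =
      {D. indep D \<and> R \<subseteq> D \<and> D \<subseteq> R \<union> G} \<union> {D. indep D \<and> insert a R \<subseteq> D \<and> D \<subseteq> insert a R \<union> G}"
    by blast
  then show ?thesis
    unfolding alternating_count_def using assms
    by (simp, intro sum.union_disjoint) (auto simp: finite_indep_between)
qed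

lemma alternating_count_required:
  assumes "finite R" "finite G" "a \<notin> R" "a \<notin> G"
    and iso: "Suc a \<notin> R \<union> G" "\<And>b. b \<in> R \<union> G \<Longrightarrow> Suc b \<noteq> a"
  shows "alternating_count (insert a R) G = - alternating_count R G"
proof -
  have "alternating_count (insert a R) G =
      (\<Sum>D | indep D \<and> R \<subseteq> D \<and> D \<subseteq> R \<union> G. (-1) ^ card (insert a D))"
    unfolding alternating_count_def
    by (rule sum.reindex_bij_witness[of _ "insert a" "\<lambda>D. D - {a}"])
      (use assms in \<open>auto simp: indep_def insert_absorb\<close>)
  also have "\<dots> = (\<Sum>D | indep D \<and> R \<subseteq> D \<and> D \<subseteq> R \<union> G. - ((-1) ^ card D))"
  proof (rule sum.cong[OF refl])
    fix D assume D: "D \<in> {D. indep D \<and> R \<subseteq> D \<and> D \<subseteq> R \<union> G}"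
    then have "finite D" "a \<notin> D"
      using assms by (auto intro: finite_subset[of _ "R \<union> G"])
    then show "(-1) ^ card (insert a D) = - ((-1) ^ card D :: int)"
      by simp
  qed
  finally show ?thesis
    by (simp add: alternating_count_def sum_negf)
qed

text \<open>
  The source of all cancellation: adding or removing an isolated vertex is a sign-reversing involution.
\<close>

lemma alternating_count_isolated:
  assumes "finite R" "finite G" "a \<notin> R" "a \<notin> G"
    and "Suc a \<notin> R \<union> G" "\<And>b. b \<in> R \<union> G \<Longrightarrow> Suc b \<noteq> a"
  shows "alternating_count R (insert a G) = 0"
  using alternating_count_insert[of R G a] alternating_count_required[of R G a] assms by simp

text \<open>
  Of the three choices on a pair (none, left, right) the first two cancel, because without its right
  vertex the left one is isolated.
\<close>

lemma alternating_count_pair: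
  assumes "finite R" "finite G" "a \<notin> R" "a \<notin> G" "Suc a \<notin> R" "Suc a \<notin> G"
    and iso: "Suc (Suc a) \<notin> R \<union> G" "\<And>b. b \<in> R \<union> G \<Longrightarrow> Suc b \<noteq> a"
  shows "alternating_count R (insert a (insert (Suc a) G)) = - alternating_count R G"
proof -
  have "alternating_count R (insert (Suc a) (insert a G)) =
      alternating_count R (insert a G) + alternating_count (insert (Suc a) R) (insert a G)"
    by (rule alternating_count_insert) (use assms in auto)
  also have "alternating_count R (insert a G) = 0"
    by (rule alternating_count_isolated) (use assms in auto)
  also have "alternating_count (insert (Suc a) R) (insert a G) = alternating_count (insert (Suc a) R) G"
    unfolding alternating_count_def
    by (intro sum.cong refl Collect_cong) (auto simp: indep_def)
  also have "\<dots> = - alternating_count R G"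
    by (rule alternating_count_required) (use assms in auto)
  finally show ?thesis
    by (simp add: insert_commute)
qed

lemma alternating_count_required_only:
  assumes "finite R" "indep R"
  shows "alternating_count R {} = (-1) ^ card R"
proof -
  have "{D. indep D \<and> R \<subseteq> D \<and> D \<subseteq> R \<union> {}} = {R}"
    using assms by auto
  then show ?thesis
    by (simp add: alternating_count_def)
qed

lemma alternating_count_pairs:
  assumes "finite E" "finite R"
    and "R \<inter> (E \<union> Suc ` E) = {}" "E \<inter> Suc ` E = {}"
    and "\<And>a. a \<in> R \<union> E \<union> Suc ` E \<Longrightarrow> Suc a \<in> R \<union> E \<union> Suc ` E \<Longrightarrow> a \<in> E"
  shows "alternating_count R (E \<union> Suc ` E) = (-1) ^ (card R + card E)"
  using assms
proof (induction E rule: finite_induct)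
  case empty
  then have "indep R"
    by (auto simp: indep_def)
  then show ?case
    using empty by (simp add: alternating_count_required_only)
next
  case (insert a E)
  have sep: "a \<notin> R" "Suc a \<notin> R" "a \<notin> Suc ` E" "Suc a \<notin> E"
    using insert.prems insert.hyps by auto
  have up: "Suc (Suc a) \<notin> R \<union> (E \<union> Suc ` E)"
    using insert.prems(4)[of "Suc a"] insert.prems(3) sep insert.hyps(2) by auto
  have down: "Suc b \<noteq> a" if "b \<in> R \<union> (E \<union> Suc ` E)" for b
    using insert.prems(4)[of b] insert.prems(2,3) sep insert.hyps(2) that by auto
  have "alternating_count R (insert a E \<union> Suc ` insert a E) =
      alternating_count R (insert a (insert (Suc a) (E \<union> Suc ` E)))"
    by (simp add: insert_commute)
  also have "\<dots> = - alternating_count R (E \<union> Suc ` E)"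
    by (rule alternating_count_pair) (use insert.hyps insert.prems(1) sep up down in auto)
  also have "alternating_count R (E \<union> Suc ` E) = (-1) ^ (card R + card E)"
  proof (rule insert.IH)
    fix b assume b: "b \<in> R \<union> E \<union> Suc ` E" "Suc b \<in> R \<union> E \<union> Suc ` E"
    have "b \<noteq> a"
      using b sep insert.hyps(2) by auto
    then show "b \<in> E"
      using insert.prems(4)[of b] b by auto
  qed (use insert.prems in auto)
  finally show ?case
    using insert.hyps by simp
qed

section \<open>Patterns and the action of the transfer operator on them\<close>

definition pattern :: "nat set \<Rightarrow> nat set \<Rightarrow> nat set \<Rightarrow> complex" where
  "pattern R G C = (if R \<subseteq> C \<and> C \<subseteq> R \<union> G then (-1) ^ card C else 0)"

lemma sum_pattern_disjoint:
  assumes RG: "R \<union> G \<subseteq> {1..K}"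
  shows "(\<Sum>D | D \<in> segment_indep_sets K \<and> C \<inter> D = {}. pattern R G D) =
    (if C \<inter> R = {} then of_int (alternating_count R (G - C)) else 0)"
proof (cases "C \<inter> R = {}")
  case True
  have "(\<Sum>D | D \<in> segment_indep_sets K \<and> C \<inter> D = {}. pattern R G D) =
      (\<Sum>D | indep D \<and> R \<subseteq> D \<and> D \<subseteq> R \<union> (G - C). (-1) ^ card D)"
    by (rule sum.mono_neutral_cong_right)
      (use RG True finite_segment_indep_sets[of K] in
        \<open>auto simp: pattern_def segment_indep_sets_def indep_def\<close>)
  then show ?thesis
    using True by (simp add: alternating_count_def)
next
  case False
  then show ?thesis
    unfolding pattern_def by (subst sum.neutral) auto
qed

text \<open>
  The sum over the independent sets disjoint from \<open>C\<close> is the alternating count of the allowed vertices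
  outside \<open>C\<close>.  It vanishes if one of these is isolated, so \<open>C\<close> must contain all of \<open>I\<close>; if \<open>C\<close> met a
  pair, it would leave the other vertex of that pair isolated, since an independent set cannot contain
  both.  Every pair avoiding \<open>C\<close> contributes a factor -1, as does every required vertex.

  The set \<open>H\<close> is prescribed only away from the neighbours of \<open>I\<close>: on independent sets, whether a
  neighbour of a required vertex is allowed makes no difference.  The hypotheses are stated vertex by
  vertex so that they can be checked separately in the three residue classes modulo 3.
\<close>

lemma transfer_pattern:
  assumes C: "C \<in> segment_indep_sets K"
    and F: "Suc ` E = F"
    and G': "\<forall>a. a \<in> G \<longleftrightarrow> a \<in> I \<or> a \<in> E \<or> a \<in> F"
    and range': "\<forall>a. a \<in> R \<or> a \<in> G \<longrightarrow> 1 \<le> a \<and> a \<le> K"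
    and disj': "\<forall>a. a \<in> R \<longrightarrow> a \<notin> G"
      "\<forall>a. a \<in> I \<longrightarrow> a \<notin> E \<and> a \<notin> F"
      "\<forall>a. a \<in> E \<longrightarrow> a \<notin> F"
    and pairs': "\<forall>a. a \<in> R \<or> a \<in> G \<longrightarrow> Suc a \<in> R \<or> Suc a \<in> G \<longrightarrow> a \<in> E"
    and H: "\<forall>a. 1 \<le> a \<longrightarrow> a \<le> K \<longrightarrow> a \<notin> I \<longrightarrow> Suc a \<notin> I \<longrightarrow> a \<notin> Suc ` I \<longrightarrow>
      (a \<in> H \<longleftrightarrow> a \<notin> R \<and> a \<notin> E \<and> a \<notin> F)"
  shows "transfer K (pattern R G) C = (-1) ^ (card R + card E) * pattern I H C"
proof -
  have G: "G = I \<union> E \<union> Suc ` E"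
    using G' F by blast
  have range: "R \<union> G \<subseteq> {1..K}"
    using range' by auto
  have disj: "R \<inter> G = {}" "I \<inter> (E \<union> Suc ` E) = {}" "E \<inter> Suc ` E = {}"
    using disj' F by blast+
  have pairs: "a \<in> E" if "a \<in> R \<union> G" "Suc a \<in> R \<union> G" for a
    using pairs' that by blast
  have fin: "finite R" "finite G" "finite E"
    using range G by (auto intro: finite_subset[OF _ finite_atLeastAtMost])
  have CK: "C \<subseteq> {1..K}" and indC: "\<And>a. a \<in> C \<Longrightarrow> Suc a \<notin> C"
    using C by (auto simp: segment_indep_sets_def)
  have target: "I \<subseteq> C \<and> C \<subseteq> I \<union> H \<longleftrightarrow> I \<subseteq> C \<and> C \<inter> (R \<union> E \<union> Suc ` E) = {}"
  proof -
    have "c \<in> I \<union> H \<longleftrightarrow> c \<notin> R \<union> E \<union> Suc ` E" if "I \<subseteq> C" "c \<in> C" for c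
    proof (cases "c \<in> I")
      case True
      then show ?thesis using disj G by auto
    next
      case False
      have "1 \<le> c" "c \<le> K" using CK that by auto
      moreover have "Suc c \<notin> I" using that indC by auto
      moreover have "c \<notin> Suc ` I" using that indC by auto
      ultimately show ?thesis using H False F by auto
    qed
    then show ?thesis by auto
  qed
  have zero: "alternating_count R (G - C) = 0"
    if a: "a \<in> G" "a \<notin> C" "Suc a \<in> R \<union> G \<Longrightarrow> Suc a \<in> C" "\<And>b. b \<in> R \<union> G \<Longrightarrow> Suc b = a \<Longrightarrow> b \<in> C"
      and CR: "C \<inter> R = {}" for a
  proof -
    have notR: "Suc a \<notin> R" "\<forall>b\<in>R. Suc b \<noteq> a"
      using a CR by blast+
    have "alternating_count R (insert a (G - C - {a})) = 0"
      by (rule alternating_count_isolated) (use a fin disj notR in auto)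
    moreover have "insert a (G - C - {a}) = G - C"
      using a by auto
    ultimately show ?thesis by simp
  qed
  have count: "alternating_count R (G - C) =
      (if I \<subseteq> C \<and> C \<inter> (E \<union> Suc ` E) = {} then (-1) ^ (card R + card E) else 0)" if CR: "C \<inter> R = {}"
  proof -
    consider (iso) a where "a \<in> I" "a \<notin> C"
      | (left) a where "a \<in> E" "a \<in> C"
      | (right) a where "a \<in> E" "Suc a \<in> C"
      | (none) "I \<subseteq> C" "C \<inter> (E \<union> Suc ` E) = {}"
      by blast
    then show ?thesis
    proof cases
      case iso
      have "alternating_count R (G - C) = 0"
      proof (rule zero[of a])
        show "Suc a \<in> C" if "Suc a \<in> R \<union> G"
          using iso that pairs[of a] G disj(2) by blast
        show "b \<in> C" if "b \<in> R \<union> G" "Suc b = a" for b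
          using iso that pairs[of b] G disj(2) by blast
      qed (use iso G CR in auto)
      then show ?thesis using iso by auto
    next
      case left
      have "alternating_count R (G - C) = 0"
      proof (rule zero[of "Suc a"])
        show "Suc (Suc a) \<in> C" if "Suc (Suc a) \<in> R \<union> G"
          using left that pairs[of "Suc a"] G disj(3) by blast
      qed (use left G CR indC in auto)
      then show ?thesis using left by auto
    next
      case right
      have "alternating_count R (G - C) = 0"
      proof (rule zero[of a])
        show "b \<in> C" if "b \<in> R \<union> G" "Suc b = a" for b
          using right that pairs[of b] G disj(3) by blast
      qed (use right G CR indC in auto)
      then show ?thesis using right by auto
    next
      case none
      have "G - C = E \<union> Suc ` E"
        using none G by auto
      moreover have "alternating_count R (E \<union> Suc ` E) = (-1) ^ (card R + card E)"
      proof (rule alternating_count_pairs)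
        show "a \<in> E" if "a \<in> R \<union> E \<union> Suc ` E" "Suc a \<in> R \<union> E \<union> Suc ` E" for a
          using that pairs[of a] G by blast
      qed (use fin disj G in auto)
      ultimately show ?thesis using none by simp
    qed
  qed
  have "transfer K (pattern R G) C =
      (-1) ^ card C * (if C \<inter> R = {} then of_int (alternating_count R (G - C)) else 0)"
    using range by (simp add: transfer_def sum_pattern_disjoint)
  also have "\<dots> = (-1) ^ (card R + card E) * pattern I H C"
    unfolding pattern_def target using count by (auto simp: Int_Un_distrib)
  finally show ?thesis .
qed

lemma pattern_missing: "a \<in> R \<Longrightarrow> a \<notin> C \<Longrightarrow> pattern R G C = 0"
  by (auto simp: pattern_def)

lemma pattern_forbidden: "a \<in> C \<Longrightarrow> a \<notin> R \<Longrightarrow> a \<notin> G \<Longrightarrow> pattern R G C = 0"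
  by (auto simp: pattern_def)

lemma pattern_reflect:
  assumes "C \<subseteq> {1..K}" "R \<subseteq> {1..K}"
  shows "pattern (reflect K R) {} C = pattern R {} (reflect K C)"
proof -
  have "C = reflect K R \<longleftrightarrow> R = reflect K C"
    using assms reflect_reflect by metis
  then show ?thesis
    using card_reflect[OF assms(1)] by (auto simp: pattern_def)
qed

section \<open>Every third vertex\<close>

text \<open>
  The vertices \<open>3j + r\<close> with \<open>p \<le> j < q\<close>.  The bounds are multiplied out because division makes linear
  arithmetic much harder.
\<close>

definition every_third :: "nat \<Rightarrow> nat \<Rightarrow> nat \<Rightarrow> nat set" where
  "every_third r p q = {a. a mod 3 = r \<and> 3 * p \<le> a \<and> a < 3 * q}"

lemma every_third_eq_image:
  assumes "r < 3"
  shows "every_third r p q = (\<lambda>j. 3 * j + r) ` {p..<q}"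
proof (intro equalityI subsetI)
  fix a assume "a \<in> every_third r p q"
  then show "a \<in> (\<lambda>j. 3 * j + r) ` {p..<q}"
    by (intro image_eqI[of _ _ "a div 3"]) (auto simp: every_third_def)
qed (use assms in \<open>auto simp: every_third_def\<close>)

lemma every_third_Suc:
  assumes "r < 3"
  shows "every_third r p (Suc q) = (if p \<le> q then insert (3 * q + r) (every_third r p q) else {})"
  using assms by (simp add: every_third_eq_image atLeastLessThanSuc)

lemma every_third_empty [simp]: "q \<le> p \<Longrightarrow> every_third r p q = {}"
  by (auto simp: every_third_def)

lemma card_every_third: "r < 3 \<Longrightarrow> card (every_third r p q) = q - p"
  by (simp add: every_third_eq_image card_image inj_on_def)

text \<open>
  Numbers of known residue modulo 3 are written with \<open>Suc\<close>, the form in which the simplifier leaves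
  \<open>3j + 1\<close>, \<open>3j + 2\<close> and their successors.
\<close>

lemma mod_3_cases:
  fixes a :: nat
  obtains j where "a = 3 * j" | j where "a = Suc (3 * j)" | j where "a = Suc (Suc (3 * j))"
proof -
  have "a = 3 * (a div 3) + a mod 3" "a mod 3 < 3" by auto
  then show thesis using that[of "a div 3"] by linarith
qed

lemma all_mod_3I:
  assumes "\<And>j. P (3 * j)" "\<And>j. P (Suc (3 * j))" "\<And>j. P (Suc (Suc (3 * j)))"
  shows "\<forall>a::nat. P a"
proof
  show "P a" for a
    using assms by (cases a rule: mod_3_cases) simp_all
qed

lemma mem_every_third_0 [simp]:
  "3 * j \<in> every_third 0 p q \<longleftrightarrow> p \<le> j \<and> j < q"
  "Suc (3 * j) \<notin> every_third 0 p q"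
  "Suc (Suc (3 * j)) \<notin> every_third 0 p q"
  "Suc (Suc (Suc (3 * j))) \<in> every_third 0 p q \<longleftrightarrow> p \<le> Suc j \<and> Suc j < q"
  unfolding every_third_def mem_Collect_eq by presburger+

lemma mem_every_third_1 [simp]:
  "3 * j \<notin> every_third (Suc 0) p q"
  "Suc (3 * j) \<in> every_third (Suc 0) p q \<longleftrightarrow> p \<le> j \<and> j < q"
  "Suc (Suc (3 * j)) \<notin> every_third (Suc 0) p q"
  "Suc (Suc (Suc (3 * j))) \<notin> every_third (Suc 0) p q"
  unfolding every_third_def mem_Collect_eq by presburger+

lemma mem_every_third_2 [simp]:
  "3 * j \<notin> every_third 2 p q"
  "Suc (3 * j) \<notin> every_third 2 p q"
  "Suc (Suc (3 * j)) \<in> every_third 2 p q \<longleftrightarrow> p \<le> j \<and> j < q"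
  "Suc (Suc (Suc (3 * j))) \<notin> every_third 2 p q"
  unfolding every_third_def mem_Collect_eq by presburger+

lemma Suc_mem_image_Suc [simp]: "Suc a \<in> Suc ` A \<longleftrightarrow> a \<in> A"
  by blast

lemma triple_mem_Suc_image: "3 * j \<in> Suc ` A \<longleftrightarrow> 0 < j \<and> Suc (Suc (3 * (j - 1))) \<in> A"
  by (cases j) auto

lemma Suc_image_every_third [simp]:
  shows "Suc ` every_third 0 p q = every_third (Suc 0) p q"
    and "Suc ` every_third (Suc 0) p q = every_third 2 p q"
    and "Suc ` every_third 2 p q = every_third 0 (Suc p) (Suc q)"
proof -
  show "Suc ` every_third 0 p q = every_third (Suc 0) p q"
  proof (rule Set.set_eqI)
    show "a \<in> Suc ` every_third 0 p q \<longleftrightarrow> a \<in> every_third (Suc 0) p q" for a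
      by (cases a rule: mod_3_cases) (auto simp: triple_mem_Suc_image)
  qed
  show "Suc ` every_third (Suc 0) p q = every_third 2 p q"
  proof (rule Set.set_eqI)
    show "a \<in> Suc ` every_third (Suc 0) p q \<longleftrightarrow> a \<in> every_third 2 p q" for a
      by (cases a rule: mod_3_cases) (auto simp: triple_mem_Suc_image)
  qed
  show "Suc ` every_third 2 p q = every_third 0 (Suc p) (Suc q)"
  proof (rule Set.set_eqI)
    show "a \<in> Suc ` every_third 2 p q \<longleftrightarrow> a \<in> every_third 0 (Suc p) (Suc q)" for a
      by (cases a rule: mod_3_cases) (auto simp: triple_mem_Suc_image)
  qed
qed

lemma reflect_every_third_1_long:
  "reflect (3 * m + 2) (every_third 1 0 (m + 1)) = every_third 2 0 (m + 1)"
proof -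
  have "(\<lambda>a. Suc (3 * m + 2) - a) ` (\<lambda>j. 3 * j + 1) ` {0..<m + 1} =
      (\<lambda>j. 3 * j + 2) ` (\<lambda>j. m - j) ` {0..<m + 1}"
    unfolding image_image by (rule image_cong) auto
  also have "(\<lambda>j. m - j) ` {0..<m + 1} = {0..<m + 1}"
  proof (intro equalityI subsetI)
    show "b \<in> (\<lambda>j. m - j) ` {0..<m + 1}" if "b \<in> {0..<m + 1}" for b
      using that by (intro image_eqI[of _ _ "m - b"]) auto
  qed auto
  finally show ?thesis
    by (simp add: reflect_def every_third_eq_image)
qed

lemma reflect_every_third_1_short:
  "reflect (3 * m) (every_third 1 0 m) = every_third 0 1 (m + 1)"
proof -
  have "(\<lambda>a. Suc (3 * m) - a) ` (\<lambda>j. 3 * j + 1) ` {0..<m} =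
      (\<lambda>j. 3 * j + 0) ` (\<lambda>j. m - j) ` {0..<m}"
    unfolding image_image by (rule image_cong) auto
  also have "(\<lambda>j. m - j) ` {0..<m} = {1..<m + 1}"
  proof (intro equalityI subsetI)
    show "b \<in> (\<lambda>j. m - j) ` {0..<m}" if "b \<in> {1..<m + 1}" for b
      using that by (intro image_eqI[of _ _ "m - b"]) auto
  qed auto
  finally show ?thesis
    by (simp add: reflect_def every_third_eq_image)
qed

lemma div_mod_3_simps:
  "Suc (3 * k) div 3 = k" "Suc (Suc (3 * k)) div 3 = k"
  "Suc (3 * k) mod 3 = 1" "Suc (Suc (3 * k)) mod 3 = 2"
  by presburger+

lemma minus_one_power_mult: "even (a + b + c) \<Longrightarrow> (-1) ^ a * ((-1) ^ b * x) = (-1) ^ c * (x :: complex)"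
  by (cases "even a"; cases "even b"; cases "even c") auto

lemma minus_one_power_cong: "even (a + b) \<Longrightarrow> (-1) ^ a = ((-1) ^ b :: complex)"
  by (cases "even a"; cases "even b") auto

lemma sum_single:
  assumes "finite A" "a \<in> A" "\<And>j. j \<in> A \<Longrightarrow> j \<noteq> a \<Longrightarrow> f j = 0"
  shows "sum f A = f a"
  using assms
  by (subst sum.mono_neutral_right[of A "{a}"]) auto

section \<open>Segments with \<open>3m + 1\<close> vertices\<close>

text \<open>
  Here the required set \<open>{1, 4, \<dots>, 3m + 1}\<close> reaches both ends, so the gaps between its vertices are all
  pairs and the background repeats after three steps without a defect.
\<close>

lemma transfer_cycle1_phase0:
  assumes C: "C \<in> segment_indep_sets (3 * m + 1)"
  shows "transfer (3 * m + 1)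
      (pattern (every_third 1 0 (m + 1)) {}) C =
    (-1) ^ (m + 1) * pattern {} (every_third 2 0 m \<union> every_third 0 1 (m + 1)) C"
  by (subst transfer_pattern[where I = "{}" and E = "{}" and
        F = "{}" and H = "every_third 2 0 m \<union> every_third 0 1 (m + 1)"],
      rule C, simp, (rule all_mod_3I; auto)+, simp add: card_every_third)

lemma transfer_cycle1_phase1:
  assumes C: "C \<in> segment_indep_sets (3 * m + 1)"
  shows "transfer (3 * m + 1)
      (pattern {} (every_third 2 0 m \<union> every_third 0 1 (m + 1))) C =
    (-1) ^ m * pattern {} (every_third 1 0 (m + 1)) C"
  by (subst transfer_pattern[where I = "{}" and E = "every_third 2 0 m" and
        F = "every_third 0 1 (m + 1)" and H = "every_third 1 0 (m + 1)"],
      rule C, simp, (rule all_mod_3I; auto)+, simp add: card_every_third)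

lemma transfer_cycle1_phase2:
  assumes C: "C \<in> segment_indep_sets (3 * m + 1)"
  shows "transfer (3 * m + 1)
      (pattern {} (every_third 1 0 (m + 1))) C =
    pattern (every_third 1 0 (m + 1)) {} C"
  by (subst transfer_pattern[where I = "every_third 1 0 (m + 1)" and E = "{}" and
        F = "{}" and H = "{}"],
      rule C, simp, (rule all_mod_3I; auto)+, simp add: card_every_third)

lemma eigenvalue_mod_3_eq_1:
  assumes Cs: "enumerates_indep_sets (3 * m + 1) Cs"
    and z: "z ^ 3 = -1" "z \<noteq> -1"
  shows "eigenvalue (transfer_matrix Cs) z"
proof -
  let ?R = "every_third 1 0 (m + 1)" and ?G = "every_third 2 0 m \<union> every_third 0 1 (m + 1)"
  let ?y = "\<lambda>j::nat. if j = 0 then pattern ?R {}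
    else if j = 1 then (\<lambda>C. (-1) ^ (m + 1) * pattern {} ?G C)
    else if j = 2 then (\<lambda>C. - pattern {} ?R C) else (\<lambda>C. - pattern ?R {} C)"
  show ?thesis
  proof (rule eigenvalue_if_periodic_orbit[OF Cs, where y = ?y and n = 3 and ?C0.0 = "{}"])
    fix j C assume "j < (3 :: nat)" and C: "C \<in> segment_indep_sets (3 * m + 1)"
    then consider "j = 0" | "j = 1" | "j = 2" by linarith
    then show "transfer (3 * m + 1) (?y j) C = ?y (Suc j) C"
    proof cases
      case 1
      then show ?thesis using transfer_cycle1_phase0[OF C] by simp
    next
      case 2
      then show ?thesis using transfer_cycle1_phase1[OF C]
        by (simp add: transfer_scale[of _ "-1", simplified] transfer_scale flip: power_add mult.assoc)
    next
      case 3
      then show ?thesis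
        using transfer_cycle1_phase2[OF C] transfer_scale[of _ "-1" "pattern {} ?R" C] by simp
    qed
  next
    show "?y 3 C = z ^ 3 * ?y 0 C" for C
      using z by simp
    show "{} \<in> segment_indep_sets (3 * m + 1)"
      by (simp add: segment_indep_sets_def)
    have "1 \<in> ?R" by (simp add: every_third_def)
    then have "pattern ?R {} {} = 0" by (rule pattern_missing) simp
    then have "(\<Sum>j<3. z ^ (3 - j) * ?y j {}) = z * (z * (-1) ^ (m + 1) - 1)"
      by (simp add: eval_nat_numeral pattern_def algebra_simps)
    moreover have "z * (-1) ^ (m + 1) \<noteq> 1"
      using z by (cases "even m") (auto simp: minus_equation_iff[of z])
    moreover have "z \<noteq> 0"
      using z by auto
    ultimately show "(\<Sum>j<3. z ^ (3 - j) * ?y j {}) \<noteq> 0"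
      by simp
  qed
qed

section \<open>Segments with \<open>3m + 2\<close> vertices\<close>

text \<open>
  The orbit of the pattern that requires \<open>{1, 4, \<dots>, 3m + 1}\<close>.  Step \<open>j\<close> is in phase \<open>j mod 3\<close>, and \<open>p\<close>
  is the block that the defect, coming from the right end, has reached.  To the left of the defect the
  vertices \<open>3j + 1\<close> are required, forbidden and allowed in turn; to the right of it this holds for the
  vertices \<open>3j + 2\<close>, two phases later.
\<close>

definition orbit2 :: "nat \<Rightarrow> nat \<Rightarrow> nat set \<Rightarrow> complex" where
  "orbit2 m j = (let p = m - j div 3 in
     if j mod 3 = 0 then
       pattern (every_third 1 0 (p + 1))
         (every_third 0 (p + 1) (m + 1) \<union> every_third 1 (p + 1) (m + 1))
     else if j mod 3 = 1 then
       (\<lambda>C. (-1) ^ (m + 1) * pattern {} (every_third 2 0 (m + 1) \<union> every_third 0 1 (p + 1)) C)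
     else
       (\<lambda>C. (-1) ^ (m - p + 1) * pattern (every_third 2 p (m + 1)) (every_third 1 0 p) C))"

lemma transfer_orbit2_phase0:
  assumes C: "C \<in> segment_indep_sets (3 * m + 2)" and p: "p \<le> m"
  shows "transfer (3 * m + 2)
      (pattern (every_third 1 0 (p + 1))
        (every_third 0 (p + 1) (m + 1) \<union> every_third 1 (p + 1) (m + 1))) C =
    (-1) ^ (m + 1) * pattern {} (every_third 2 0 (m + 1) \<union> every_third 0 1 (p + 1)) C"
  by (subst transfer_pattern[where I = "{}" and E = "every_third 0 (p + 1) (m + 1)" and
        F = "every_third 1 (p + 1) (m + 1)" and H = "every_third 2 0 (m + 1) \<union> every_third 0 1 (p + 1)"],
      rule C, simp, (rule all_mod_3I; use p in auto)+, use p in \<open>simp add: card_every_third\<close>)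

lemma transfer_orbit2_phase1:
  assumes C: "C \<in> segment_indep_sets (3 * m + 2)" and p: "p \<le> m"
  shows "transfer (3 * m + 2)
      (pattern {} (every_third 2 0 (m + 1) \<union> every_third 0 1 (p + 1))) C =
    (-1) ^ p * pattern (every_third 2 p (m + 1)) (every_third 1 0 p) C"
  by (subst transfer_pattern[where I = "every_third 2 p (m + 1)" and E = "every_third 2 0 p" and
        F = "every_third 0 1 (p + 1)" and H = "every_third 1 0 p"],
      rule C, simp, (rule all_mod_3I; use p in auto)+, use p in \<open>simp add: card_every_third\<close>)

lemma transfer_orbit2_phase2:
  assumes C: "C \<in> segment_indep_sets (3 * m + 2)" and p: "p < m"
  shows "transfer (3 * m + 2)
      (pattern (every_third 2 (p + 1) (m + 1)) (every_third 1 0 (p + 1))) C =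
    (-1) ^ (m - p) * pattern (every_third 1 0 (p + 1))
        (every_third 0 (p + 1) (m + 1) \<union> every_third 1 (p + 1) (m + 1)) C"
  by (subst transfer_pattern[where I = "every_third 1 0 (p + 1)" and E = "{}" and
        F = "{}" and H = "every_third 0 (p + 1) (m + 1) \<union> every_third 1 (p + 1) (m + 1)"],
      rule C, simp, (rule all_mod_3I; use p in auto)+, use p in \<open>simp add: card_every_third\<close>)

lemma orbit2_simps:
  "orbit2 m (3 * k) C = pattern (every_third 1 0 (m - k + 1))
     (every_third 0 (m - k + 1) (m + 1) \<union> every_third 1 (m - k + 1) (m + 1)) C"
  "orbit2 m (Suc (3 * k)) C =
     (-1) ^ (m + 1) * pattern {} (every_third 2 0 (m + 1) \<union> every_third 0 1 (m - k + 1)) C"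
  "orbit2 m (Suc (Suc (3 * k))) C =
     (-1) ^ (m - (m - k) + 1) * pattern (every_third 2 (m - k) (m + 1)) (every_third 1 0 (m - k)) C"
  unfolding orbit2_def Let_def div_mod_3_simps by simp_all

lemma transfer_orbit2:
  assumes j: "j < 3 * m + 2" and C: "C \<in> segment_indep_sets (3 * m + 2)"
  shows "transfer (3 * m + 2) (orbit2 m j) C = orbit2 m (Suc j) C"
proof (cases j rule: mod_3_cases)
  case (1 k)
  have "transfer (3 * m + 2) (orbit2 m j) C =
     transfer (3 * m + 2) (pattern (every_third 1 0 (m - k + 1))
        (every_third 0 (m - k + 1) (m + 1) \<union> every_third 1 (m - k + 1) (m + 1))) C"
    unfolding 1 by (rule transfer_cong) (rule orbit2_simps)
  also have "\<dots> = orbit2 m (Suc j) C"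
    unfolding 1 orbit2_simps by (rule transfer_orbit2_phase0) (use C in auto)
  finally show ?thesis .
next
  case (2 k)
  have "transfer (3 * m + 2) (orbit2 m j) C = (-1) ^ (m + 1) *
     transfer (3 * m + 2) (pattern {} (every_third 2 0 (m + 1) \<union> every_third 0 1 (m - k + 1))) C"
    unfolding 2 transfer_scale[symmetric] by (rule transfer_cong) (rule orbit2_simps)
  also have "\<dots> = (-1) ^ (m + 1) * ((-1) ^ (m - k) *
     pattern (every_third 2 (m - k) (m + 1)) (every_third 1 0 (m - k)) C)"
    by (subst transfer_orbit2_phase1) (use C in auto)
  also have "\<dots> = orbit2 m (Suc j) C"
    unfolding 2 orbit2_simps by (rule minus_one_power_mult) auto
  finally show ?thesis .
next
  case (3 k)
  define p where "p = m - Suc k"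
  have p: "m - k = p + 1" "p < m" "3 * Suc k = Suc (Suc (Suc (3 * k)))"
    using 3 j by (auto simp: p_def)
  have "transfer (3 * m + 2) (orbit2 m j) C = (-1) ^ (m - (m - k) + 1) *
     transfer (3 * m + 2) (pattern (every_third 2 (p + 1) (m + 1)) (every_third 1 0 (p + 1))) C"
    unfolding 3 transfer_scale[symmetric] by (rule transfer_cong) (simp only: orbit2_simps p)
  also have "\<dots> = (-1) ^ (m - (m - k) + 1) * ((-1) ^ (m - p) * pattern (every_third 1 0 (p + 1))
     (every_third 0 (p + 1) (m + 1) \<union> every_third 1 (p + 1) (m + 1)) C)"
    by (subst transfer_orbit2_phase2) (use C p in auto)
  also have "\<dots> = (-1) ^ 0 * pattern (every_third 1 0 (p + 1))
     (every_third 0 (p + 1) (m + 1) \<union> every_third 1 (p + 1) (m + 1)) C"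
    by (rule minus_one_power_mult) (use p in auto)
  also have "\<dots> = orbit2 m (3 * Suc k) C"
    unfolding orbit2_simps p_def by simp
  finally show ?thesis
    unfolding p 3 .
qed

text \<open>After \<open>3m + 2\<close> steps the defect has reached block 0 and the background is mirrored.\<close>

lemma orbit2_end:
  assumes C: "C \<in> segment_indep_sets (3 * m + 2)"
  shows "orbit2 m (3 * m + 2) C = (-1) ^ (m + 1) * orbit2 m 0 (reflect (3 * m + 2) C)"
proof -
  have "every_third 1 0 (m + 1) \<subseteq> {1..3 * m + 2}"
    unfolding every_third_def subset_iff mem_Collect_eq atLeastAtMost_iff by presburger
  then have "pattern (every_third 2 0 (m + 1)) {} C =
      pattern (every_third 1 0 (m + 1)) {} (reflect (3 * m + 2) C)"
    using pattern_reflect[OF segment_indep_setsD[OF C]] reflect_every_third_1_long by metis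
  then show ?thesis
    using orbit2_simps(1)[of m 0] orbit2_simps(3)[of m m] by simp
qed

text \<open>
  Phase 0 requires the vertex 1 and phase 2 the last vertex, so at sets avoiding both ends only phase 1
  matters, for the orbit and for its mirror image alike.
\<close>

lemma orbit2_eq_0:
  assumes j: "j < 3 * m + 2" "j mod 3 \<noteq> 1" and C: "1 \<notin> C" "3 * m + 2 \<notin> C"
  shows "orbit2 m j C = 0"
proof (cases j rule: mod_3_cases)
  case (1 k)
  show ?thesis
    unfolding 1 orbit2_simps
    by (rule pattern_missing[of 1]) (use C in \<open>auto simp: every_third_def\<close>)
next
  case (2 k)
  then show ?thesis using j by (simp add: div_mod_3_simps)
next
  case (3 k)
  have "3 * m + 2 \<in> every_third 2 (m - k) (m + 1)"
    by simp
  then have "pattern (every_third 2 (m - k) (m + 1)) (every_third 1 0 (m - k)) C = 0"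
    using C(2) by (rule pattern_missing)
  then show ?thesis
    unfolding 3 orbit2_simps by simp
qed

lemma eigenvalue_mod_3_eq_2:
  assumes Cs: "enumerates_indep_sets (3 * m + 2) Cs"
    and z: "z ^ (2 * (3 * m + 2)) = 1" "z \<noteq> -1"
  shows "eigenvalue (transfer_matrix Cs) z"
proof -
  let ?K = "3 * m + 2"
  let ?v = "\<lambda>C. \<Sum>j<?K. z ^ (?K - j) *
    (orbit2 m j C + z ^ ?K * (-1) ^ (m + 1) * orbit2 m j (reflect ?K C))"
  have eig: "eigenvalue (transfer_matrix Cs) z" if "C \<in> segment_indep_sets ?K" "?v C \<noteq> 0" for C
    by (rule eigenvalue_if_reflected_orbit[OF Cs transfer_orbit2 orbit2_end _ z(1) that])
      (simp_all flip: power_add)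
  have nz: "z \<noteq> 0"
    using z(1) by auto
  consider "m = 0" | "m = 1" | "2 \<le> m" by linarith
  then show ?thesis
  proof cases
    case 1
    have "?v {2} = z ^ 4 + z"
      unfolding 1 using orbit2_simps[of 0 0]
      by (simp add: eval_nat_numeral reflect_def pattern_def every_third_Suc)
    also have "\<dots> \<noteq> 0"
      using z 1 by (simp add: add_eq_0_iff)
    finally show ?thesis
      by (rule eig[rotated]) (simp add: segment_indep_sets_def 1)
  next
    case 2
    have vals: "?v {2} = - (z * (z ^ 3 + 1))" "?v {3} = - (z ^ 4 * (z ^ 5 + 1))"
      unfolding 2 using orbit2_simps[of 1 0] orbit2_simps[of 1 1]
      by (simp_all add: eval_nat_numeral reflect_def pattern_def every_third_Suc algebra_simps)
    have "?v {2} \<noteq> 0 \<or> ?v {3} \<noteq> 0"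
    proof (rule ccontr)
      assume "\<not> ?thesis"
      then have "z * (z ^ 3 + 1) = 0" "z ^ 4 * (z ^ 5 + 1) = 0"
        unfolding vals by simp_all
      then have pow: "z ^ 3 = -1" "z ^ 5 = -1"
        using nz by (simp_all add: eq_neg_iff_add_eq_0)
      moreover have "z ^ 5 = z ^ 3 * z ^ 2" "z ^ 3 = z * z ^ 2"
        by (simp_all add: eval_nat_numeral)
      ultimately show False
        using z(2) by simp
    qed
    moreover have "{2} \<in> segment_indep_sets ?K" "{3} \<in> segment_indep_sets ?K"
      by (simp_all add: segment_indep_sets_def 2)
    ultimately show ?thesis
      using eig by blast
  next
    case 3
    \<comment> \<open>In phase 1 the vertex \<open>3m\<close> is allowed only at step 1, and the mirror image \<open>3m + 1\<close> of the
      vertex 2 is never allowed.\<close>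
    let ?C = "{2, 3 * m}"
    have refl: "reflect ?K ?C = {Suc (3 * m), 3}"
      using 3 by (auto simp: reflect_def)
    have zero: "orbit2 m j ?C = 0" if "j < ?K" "j \<noteq> 1" for j
    proof (cases j rule: mod_3_cases)
      case (2 k)
      have "pattern {} (every_third 2 0 (m + 1) \<union> every_third 0 1 (m - k + 1)) ?C = 0"
        by (rule pattern_forbidden[of "3 * m"]) (use 2 that 3 in auto)
      then show ?thesis
        unfolding 2 orbit2_simps by simp
    qed (use that 3 in \<open>auto intro!: orbit2_eq_0 simp: div_mod_3_simps\<close>)
    have zero': "orbit2 m j {Suc (3 * m), 3} = 0" if "j < ?K" for j
    proof (cases j rule: mod_3_cases)
      case (2 k)
      have "pattern {} (every_third 2 0 (m + 1) \<union> every_third 0 1 (m - k + 1)) {Suc (3 * m), 3} = 0"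
        by (rule pattern_forbidden[of "Suc (3 * m)"]) simp_all
      then show ?thesis
        unfolding 2 orbit2_simps by simp
    qed (use that 3 in \<open>auto intro!: orbit2_eq_0 simp: div_mod_3_simps\<close>)
    have "?v ?C = z ^ (?K - 1) * orbit2 m 1 ?C"
      unfolding refl by (subst sum_single[of _ 1]) (auto simp: zero zero')
    moreover have "orbit2 m 1 ?C \<noteq> 0"
      using orbit2_simps(2)[of m 0 ?C] 3
      by (simp add: pattern_def every_third_def)
    moreover have "?C \<in> segment_indep_sets ?K"
      using 3 by (auto simp: segment_indep_sets_def)
    ultimately show ?thesis
      using eig nz by simp
  qed
qed

section \<open>Segments with \<open>3m\<close> vertices\<close>

text \<open>
  The orbit of the pattern that requires \<open>{1, 4, \<dots>, 3m - 2}\<close>, with phases and defect as before.  The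
  minimum differs from \<open>p + 1\<close> only at step 0, where \<open>3m + 1\<close> would be the next required vertex but
  lies outside the segment; therefore steps 0 and 3 have the same required set.
\<close>

definition orbit0 :: "nat \<Rightarrow> nat \<Rightarrow> nat set \<Rightarrow> complex" where
  "orbit0 m j = (let p = m - j div 3 in
     if j mod 3 = 0 then
       (\<lambda>C. (-1) ^ (m + min m (p + 1)) *
         pattern (every_third 1 0 (min m (p + 1))) (every_third 0 (p + 1) (m + 1)) C)
     else if j mod 3 = 1 then
       (\<lambda>C. (-1) ^ m *
         pattern (every_third 0 (p + 1) (m + 1)) (every_third 2 0 p \<union> every_third 0 1 (p + 1)) C)
     else pattern {} (every_third 1 0 m \<union> every_third 2 p m))"

lemma transfer_orbit0_phase0:
  assumes C: "C \<in> segment_indep_sets (3 * m)" and p: "p \<le> m"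
  shows "transfer (3 * m)
      (pattern (every_third 1 0 (min m (p + 1))) (every_third 0 (p + 1) (m + 1))) C =
    (-1) ^ min m (p + 1) * pattern (every_third 0 (p + 1) (m + 1))
        (every_third 2 0 p \<union> every_third 0 1 (p + 1)) C"
  by (subst transfer_pattern[where I = "every_third 0 (p + 1) (m + 1)" and E = "{}" and
        F = "{}" and H = "every_third 2 0 p \<union> every_third 0 1 (p + 1)"],
      rule C, simp, (rule all_mod_3I; use p in auto)+, use p in \<open>simp add: card_every_third\<close>)

lemma transfer_orbit0_phase1:
  assumes C: "C \<in> segment_indep_sets (3 * m)" and p: "p < m"
  shows "transfer (3 * m)
      (pattern (every_third 0 (p + 2) (m + 1)) (every_third 2 0 (p + 1) \<union> every_third 0 1 (p + 2))) C =
    (-1) ^ m * pattern {} (every_third 1 0 m \<union> every_third 2 (p + 1) m) C"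
  by (subst transfer_pattern[where I = "{}" and E = "every_third 2 0 (p + 1)" and
        F = "every_third 0 1 (p + 2)" and H = "every_third 1 0 m \<union> every_third 2 (p + 1) m"],
      rule C, simp, (rule all_mod_3I; use p in auto)+, use p in \<open>simp add: card_every_third\<close>)

lemma transfer_orbit0_phase2:
  assumes C: "C \<in> segment_indep_sets (3 * m)" and p: "p < m"
  shows "transfer (3 * m)
      (pattern {} (every_third 1 0 m \<union> every_third 2 (p + 1) m)) C =
    (-1) ^ (m - (p + 1)) * pattern (every_third 1 0 (p + 1)) (every_third 0 (p + 1) (m + 1)) C"
  by (subst transfer_pattern[where I = "every_third 1 0 (p + 1)" and E = "every_third 1 (p + 1) m" and
        F = "every_third 2 (p + 1) m" and H = "every_third 0 (p + 1) (m + 1)"],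
      rule C, simp, (rule all_mod_3I; use p in auto)+, use p in \<open>simp add: card_every_third\<close>)

lemma orbit0_simps:
  "orbit0 m (3 * k) C = (-1) ^ (m + min m (m - k + 1)) *
     pattern (every_third 1 0 (min m (m - k + 1))) (every_third 0 (m - k + 1) (m + 1)) C"
  "orbit0 m (Suc (3 * k)) C = (-1) ^ m * pattern (every_third 0 (m - k + 1) (m + 1))
     (every_third 2 0 (m - k) \<union> every_third 0 1 (m - k + 1)) C"
  "orbit0 m (Suc (Suc (3 * k))) C = pattern {} (every_third 1 0 m \<union> every_third 2 (m - k) m) C"
  unfolding orbit0_def Let_def div_mod_3_simps by simp_all

lemma transfer_orbit0:
  assumes j: "j < 3 * m + 1" and C: "C \<in> segment_indep_sets (3 * m)"
  shows "transfer (3 * m) (orbit0 m j) C = orbit0 m (Suc j) C"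
proof (cases j rule: mod_3_cases)
  case (1 k)
  have "transfer (3 * m) (orbit0 m j) C = (-1) ^ (m + min m (m - k + 1)) *
     transfer (3 * m) (pattern (every_third 1 0 (min m (m - k + 1)))
        (every_third 0 (m - k + 1) (m + 1))) C"
    unfolding 1 transfer_scale[symmetric] by (rule transfer_cong) (rule orbit0_simps)
  also have "\<dots> = (-1) ^ (m + min m (m - k + 1)) * ((-1) ^ (min m (m - k + 1)) *
     pattern (every_third 0 (m - k + 1) (m + 1))
       (every_third 2 0 (m - k) \<union> every_third 0 1 (m - k + 1)) C)"
    by (subst transfer_orbit0_phase0) (use C in auto)
  also have "\<dots> = orbit0 m (Suc j) C"
    unfolding 1 orbit0_simps by (rule minus_one_power_mult) auto
  finally show ?thesis .
next
  case (2 k)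
  define p where "p = m - Suc k"
  have p: "m - k = p + 1" "p < m" "p + 1 + 1 = p + 2"
    using 2 j by (auto simp: p_def)
  have "transfer (3 * m) (orbit0 m j) C = (-1) ^ m *
     transfer (3 * m) (pattern (every_third 0 (p + 2) (m + 1))
        (every_third 2 0 (p + 1) \<union> every_third 0 1 (p + 2))) C"
    unfolding 2 transfer_scale[symmetric] by (rule transfer_cong) (simp only: orbit0_simps p)
  also have "\<dots> = (-1) ^ m * ((-1) ^ m * pattern {} (every_third 1 0 m \<union> every_third 2 (p + 1) m) C)"
    by (subst transfer_orbit0_phase1) (use C p in auto)
  also have "\<dots> = (-1) ^ 0 * pattern {} (every_third 1 0 m \<union> every_third 2 (p + 1) m) C"
    by (rule minus_one_power_mult) auto
  also have "\<dots> = orbit0 m (Suc j) C"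
    unfolding 2 orbit0_simps p by simp
  finally show ?thesis .
next
  case (3 k)
  define p where "p = m - Suc k"
  have p: "m - k = p + 1" "p < m" "min m (p + 1) = p + 1" "3 * Suc k = Suc (Suc (Suc (3 * k)))"
    using 3 j by (auto simp: p_def)
  have "transfer (3 * m) (orbit0 m j) C =
     transfer (3 * m) (pattern {} (every_third 1 0 m \<union> every_third 2 (p + 1) m)) C"
    unfolding 3 by (rule transfer_cong) (simp only: orbit0_simps p)
  also have "\<dots> = (-1) ^ (m - (p + 1)) *
     pattern (every_third 1 0 (p + 1)) (every_third 0 (p + 1) (m + 1)) C"
    by (subst transfer_orbit0_phase2) (use C p in auto)
  also have "(-1) ^ (m - (p + 1)) = ((-1) ^ (m + (p + 1)) :: complex)"
    using p(2) by (intro minus_one_power_cong) simp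
  also have "\<dots> * pattern (every_third 1 0 (p + 1)) (every_third 0 (p + 1) (m + 1)) C =
     orbit0 m (3 * Suc k) C"
    unfolding orbit0_simps p_def[symmetric] p(3) ..
  finally show ?thesis
    unfolding p 3 .
qed

lemma orbit0_end:
  assumes C: "C \<in> segment_indep_sets (3 * m)"
  shows "orbit0 m (3 * m + 1) C = (-1) ^ m * orbit0 m 0 (reflect (3 * m) C)"
proof -
  have "every_third 1 0 m \<subseteq> {1..3 * m}"
    unfolding every_third_def subset_iff mem_Collect_eq atLeastAtMost_iff by presburger
  then have "pattern (every_third 0 1 (m + 1)) {} C =
      pattern (every_third 1 0 m) {} (reflect (3 * m) C)"
    using pattern_reflect[OF segment_indep_setsD[OF C]] reflect_every_third_1_short by metis
  then show ?thesis
    using orbit0_simps(1)[of m 0] orbit0_simps(2)[of m m]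
    by (simp add: min_def flip: mult_2)
qed

text \<open>
  If \<open>m \<ge> 2\<close>, then only one term of the sum survives at \<open>{3, 3m - 1}\<close>.  For \<open>m = 1\<close> this set is not
  independent; the value at \<open>{2}\<close> vanishes exactly at the fourth roots of unity, of which the value at
  \<open>{1}\<close> recovers the number 1.
\<close>

lemma eigenvalue_mod_3_eq_0:
  assumes Cs: "enumerates_indep_sets (3 * m) Cs" and m: "1 \<le> m"
    and z: "z ^ (2 * (3 * m + 1)) = 1"
    and exc: "m = 1 \<Longrightarrow> z \<noteq> -1 \<and> z \<noteq> \<i> \<and> z \<noteq> - \<i>"
  shows "eigenvalue (transfer_matrix Cs) z"
proof -
  let ?n = "3 * m + 1"
  let ?v = "\<lambda>C. \<Sum>j<?n. z ^ (?n - j) *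
    (orbit0 m j C + z ^ ?n * (-1) ^ m * orbit0 m j (reflect (3 * m) C))"
  have eig: "eigenvalue (transfer_matrix Cs) z" if "C \<in> segment_indep_sets (3 * m)" "?v C \<noteq> 0" for C
    by (rule eigenvalue_if_reflected_orbit[OF Cs transfer_orbit0 orbit0_end _ z that])
      (simp_all flip: power_add)
  have nz: "z \<noteq> 0"
    using z by auto
  consider "m = 1" | "2 \<le> m" using m by linarith
  then show ?thesis
  proof cases
    case 1
    have vals: "?v {2} = z ^ 3 * (1 - z ^ 4)" "z = 1 \<Longrightarrow> ?v {1} = - 4"
      unfolding 1 using orbit0_simps[of 1 0] orbit0_simps[of 1 1]
      by (simp_all add: eval_nat_numeral reflect_def pattern_def every_third_Suc algebra_simps)
    have "?v {2} \<noteq> 0 \<or> ?v {1} \<noteq> 0"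
    proof (rule ccontr)
      assume "\<not> ?thesis"
      then have "z ^ 4 = 1" "z \<noteq> 1"
        using vals nz by auto
      moreover have "z ^ 4 - 1 = (z - 1) * (z + 1) * (z - \<i>) * (z + \<i>)"
        by (simp add: algebra_simps eval_nat_numeral)
      ultimately show False
        using exc[OF 1] by (auto simp: eq_neg_iff_add_eq_0)
    qed
    moreover have "{2} \<in> segment_indep_sets (3 * m)" "{1} \<in> segment_indep_sets (3 * m)"
      by (simp_all add: segment_indep_sets_def 1)
    ultimately show ?thesis
      using eig by blast
  next
    case 2
    \<comment> \<open>Phase 0 requires the vertex 1, and phase 2 forbids the vertices 2 and 3.  Phase 1 requires the
      vertex \<open>3m\<close> after step 1 and always forbids \<open>3m - 2\<close>, the mirror image of 3.\<close>
    let ?C = "{3, Suc (Suc (3 * (m - 1)))}"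
    have refl: "reflect (3 * m) ?C = {Suc (3 * (m - 1)), 2}"
      using 2 by (auto simp: reflect_def)
    have zero: "orbit0 m j ?C = 0" if "j < ?n" "j \<noteq> 1" for j
    proof (cases j rule: mod_3_cases)
      case (1 k)
      have "pattern (every_third 1 0 (min m (m - k + 1)))
          (every_third 0 (m - k + 1) (m + 1)) ?C = 0"
        by (rule pattern_missing[of 1]) (use 2 in \<open>auto simp: every_third_def min_def\<close>)
      then show ?thesis
        unfolding 1 orbit0_simps by simp
    next
      case (2 k)
      have "pattern (every_third 0 (m - k + 1) (m + 1))
          (every_third 2 0 (m - k) \<union> every_third 0 1 (m - k + 1)) ?C = 0"
        by (rule pattern_missing[of "3 * m"]) (use 2 \<open>2 \<le> m\<close> that in auto)
      then show ?thesis
        unfolding 2 orbit0_simps by simp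
    next
      case (3 k)
      show ?thesis
        unfolding 3 orbit0_simps
        by (rule pattern_forbidden[of 3]) (auto simp: every_third_def)
    qed
    have zero': "orbit0 m j {Suc (3 * (m - 1)), 2} = 0" if "j < ?n" for j
    proof (cases j rule: mod_3_cases)
      case (1 k)
      have "pattern (every_third 1 0 (min m (m - k + 1)))
          (every_third 0 (m - k + 1) (m + 1)) {Suc (3 * (m - 1)), 2} = 0"
        by (rule pattern_missing[of 1]) (use 2 in \<open>auto simp: every_third_def min_def\<close>)
      then show ?thesis
        unfolding 1 orbit0_simps by simp
    next
      case (2 k)
      have "pattern (every_third 0 (m - k + 1) (m + 1))
          (every_third 2 0 (m - k) \<union> every_third 0 1 (m - k + 1)) {Suc (3 * (m - 1)), 2} = 0"
        by (rule pattern_forbidden[of "Suc (3 * (m - 1))"]) simp_all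
      then show ?thesis
        unfolding 2 orbit0_simps by simp
    next
      case (3 k)
      have "3 * 1 \<le> 3 * (m - k)"
        using 3 that by (intro mult_le_mono2) auto
      then have "2 \<notin> every_third 1 0 m \<union> every_third 2 (m - k) m"
        by (auto simp: every_third_def)
      then show ?thesis
        unfolding 3 orbit0_simps by (intro pattern_forbidden[of 2]) auto
    qed
    have "?v ?C = z ^ (?n - 1) * orbit0 m 1 ?C"
      unfolding refl by (subst sum_single[of _ 1]) (use m in \<open>simp_all add: zero zero' del: One_nat_def\<close>)
    moreover have "orbit0 m 1 ?C \<noteq> 0"
    proof -
      have "3 \<in> every_third 0 1 (m + 1)" "Suc (Suc (3 * (m - 1))) \<in> every_third 2 0 m"
        using 2 by (simp_all add: every_third_def[of 0])
      then show ?thesis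
        using orbit0_simps(2)[of m 0 ?C] by (simp add: pattern_def)
    qed
    moreover have "?C \<in> segment_indep_sets (3 * m)"
      using 2 by (auto simp: segment_indep_sets_def)
    ultimately show ?thesis
      using eig nz by simp
  qed
qed

section \<open>The eigenvalues\<close>

theorem proposition13:
  fixes K :: nat and Cs :: "nat set list"
  assumes "K \<ge> 1"
    and "enumerates_indep_sets K Cs"
  shows "(K mod 3 = 1 \<longrightarrow>
            eigenvalue (transfer_matrix Cs) (exp (\<i> * of_real pi / 3)) \<and>
            eigenvalue (transfer_matrix Cs) (exp (- \<i> * of_real pi / 3))) \<and>
         (K mod 3 = 2 \<longrightarrow>
            (\<forall>z::complex. z ^ (2 * K) = 1 \<and> z \<noteq> -1 \<longrightarrow>
               eigenvalue (transfer_matrix Cs) z)) \<and>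
         (K mod 3 = 0 \<longrightarrow>
            (\<forall>z::complex. z ^ (2 * K + 2) = 1 \<and> z \<noteq> -1 \<and>
                 (odd K \<longrightarrow> z \<noteq> \<i> \<and> z \<noteq> -\<i>) \<longrightarrow>
               eigenvalue (transfer_matrix Cs) z))"
proof (intro conjI allI impI)
  define m where "m = K div 3"
  have K: "K = 3 * m + K mod 3"
    by (simp add: m_def)
  {
    assume "K mod 3 = 1"
    then have Cs: "enumerates_indep_sets (3 * m + 1) Cs"
      using assms(2) K by simp
    have cube: "exp w ^ 3 = exp (3 * w)" for w :: complex
      by (simp add: exp_of_nat_mult[of 3, simplified])
    have "exp (\<i> * of_real pi / 3) \<noteq> -1" "exp (- \<i> * of_real pi / 3) \<noteq> -1"
      by (auto simp: complex_eq_iff Re_exp cos_60)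
    moreover have "exp (\<i> * of_real pi / 3) ^ 3 = -1" "exp (- \<i> * of_real pi / 3) ^ 3 = -1"
      unfolding cube by (simp_all add: exp_minus mult.commute[of \<i>])
    ultimately show "eigenvalue (transfer_matrix Cs) (exp (\<i> * of_real pi / 3))"
      "eigenvalue (transfer_matrix Cs) (exp (- \<i> * of_real pi / 3))"
      using eigenvalue_mod_3_eq_1[OF Cs] by blast+
  }
  show "eigenvalue (transfer_matrix Cs) z" if "K mod 3 = 2" "z ^ (2 * K) = 1 \<and> z \<noteq> -1" for z
    using that assms(2) K eigenvalue_mod_3_eq_2[of m Cs z] by simp
  show "eigenvalue (transfer_matrix Cs) z"
    if "K mod 3 = 0" "z ^ (2 * K + 2) = 1 \<and> z \<noteq> -1 \<and> (odd K \<longrightarrow> z \<noteq> \<i> \<and> z \<noteq> -\<i>)" for z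
  proof (rule eigenvalue_mod_3_eq_0)
    have K': "K = 3 * m"
      using K that(1) by simp
    show "enumerates_indep_sets (3 * m) Cs" "1 \<le> m"
      using assms K' by auto
    show "z ^ (2 * (3 * m + 1)) = 1"
      using that(2) K' by simp
    show "z \<noteq> -1 \<and> z \<noteq> \<i> \<and> z \<noteq> -\<i>" if "m = 1"
      using \<open>z ^ _ = _ \<and> _\<close> that K' by simp
  qed
qed

end
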